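(* Suppose that $(M,\tau)$ is a (right) powder monoid and let $(L,\rho)$ be the opposite of the topological monoid of endomorphisms of the canonical point of $\mathrm{Cont}(M,\tau)$. Then the canonical monoid homomorphism $u:M\to L$ is injective and continuous with respect to $\tau$ and $\rho$.
   Context: An $(M,\tau)$-set is a right $M$-set $X$ whose action $X\times M\to X$ is continuous when $X$ is given the discrete topology; $\mathrm{Cont}(M,\tau)$ is the category of $(M,\tau)$-sets and equivariant maps; its canonical point has the forgetful functor to $\mathbf{Set}$ as inverse image. A right congruence on $M$ is an equivalence relation $r\subseteq M\times M$ with $(p,q)\in r\Rightarrow(pm,qm)\in r$; $m^*(r)=\{(x,y)\mid(mx,my)\in r\}$. Let $\mathcal{R}_\tau$ be the inclusion-ordered set of right congruences $r$ such that $M/r$ is an $(M,\tau)$-set. $L$, the opposite of the monoid of natural endomorphisms of the forgetful functor $\mathrm{Cont}(M,\tau)\to\mathbf{Set}$, is identified with $\varprojlim_{r\in\mathcal{R}_\tau}M/r$: elements are compatible tuples $([a_r])_r$, with product $([a_r])_r([b_r])_r=([a_r\,b_{a_r^*(r)}])_r$; $\rho$ is the coarsest topology making all projections $L\to M/r$ to discrete sets continuous; and $u(m)=([m])_r$. For $A\subseteq M$, $p\in M$: $p^*(A)=\{m\mid pm\in A\}$, $\mathcal{I}_A^p=\{m\mid m^*(A)=p^*(A)\}$. $\tau$ is an action topology if it coincides with the topology having base $\{A\mid\forall p,q,\ \mathcal{I}^p_{q^*(A)}\in\tau\}$. A (right) powder monoid is a $T_0$ topological monoid whose topology is an action topology.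 *)

theory Defs
  imports "HOL-Analysis.Analysis" "HOL-Algebra.Group"
begin

definition topological_monoid :: "('m, 'b) monoid_scheme \<Rightarrow> 'm topology \<Rightarrow> bool" where
  "topological_monoid M \<tau> \<longleftrightarrow>
     monoid M \<and> topspace \<tau> = carrier M \<and>
     continuous_map (prod_topology \<tau> \<tau>) \<tau> (\<lambda>(x, y). x \<otimes>\<^bsub>M\<^esub> y)"

definition right_M_set :: "('m, 'b) monoid_scheme \<Rightarrow> 'x set \<Rightarrow> ('x \<Rightarrow> 'm \<Rightarrow> 'x) \<Rightarrow> bool" where
  "right_M_set M X act \<longleftrightarrow>
     (\<forall>x\<in>X. \<forall>m\<in>carrier M. act x m \<in> X) \<and>
     (\<forall>x\<in>X. act x \<one>\<^bsub>M\<^esub> = x) \<and>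
     (\<forall>x\<in>X. \<forall>m\<in>carrier M. \<forall>n\<in>carrier M. act (act x m) n = act x (m \<otimes>\<^bsub>M\<^esub> n))"

definition continuous_M_set ::
    "('m, 'b) monoid_scheme \<Rightarrow> 'm topology \<Rightarrow> 'x set \<Rightarrow> ('x \<Rightarrow> 'm \<Rightarrow> 'x) \<Rightarrow> bool" where
  "continuous_M_set M \<tau> X act \<longleftrightarrow>
     right_M_set M X act \<and>
     continuous_map (prod_topology (discrete_topology X) \<tau>) (discrete_topology X)
       (\<lambda>(x, m). act x m)"

definition equivariant ::
    "('m, 'b) monoid_scheme \<Rightarrow> 'x set \<Rightarrow> ('x \<Rightarrow> 'm \<Rightarrow> 'x) \<Rightarrow> 'y set \<Rightarrow> ('y \<Rightarrow> 'm \<Rightarrow> 'y)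
      \<Rightarrow> ('x \<Rightarrow> 'y) \<Rightarrow> bool" where
  "equivariant M X act Y act' f \<longleftrightarrow>
     f \<in> X \<rightarrow> Y \<and> (\<forall>x\<in>X. \<forall>m\<in>carrier M. f (act x m) = act' (f x) m)"


definition right_congruence :: "('m, 'b) monoid_scheme \<Rightarrow> ('m \<times> 'm) set \<Rightarrow> bool" where
  "right_congruence M r \<longleftrightarrow>
     equiv (carrier M) r \<and>
     (\<forall>p q. \<forall>m\<in>carrier M. (p, q) \<in> r \<longrightarrow> (p \<otimes>\<^bsub>M\<^esub> m, q \<otimes>\<^bsub>M\<^esub> m) \<in> r)"

definition quot_act :: "('m, 'b) monoid_scheme \<Rightarrow> ('m \<times> 'm) set \<Rightarrow> 'm set \<Rightarrow> 'm \<Rightarrow> 'm set" where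
  "quot_act M r c m = (\<Union>a\<in>c. r `` {a \<otimes>\<^bsub>M\<^esub> m})"

definition cont_congs :: "('m, 'b) monoid_scheme \<Rightarrow> 'm topology \<Rightarrow> ('m \<times> 'm) set set" where
  "cont_congs M \<tau> =
     {r. right_congruence M r \<and> continuous_M_set M \<tau> (carrier M // r) (quot_act M r)}"

definition pull_cong :: "('m, 'b) monoid_scheme \<Rightarrow> 'm \<Rightarrow> ('m \<times> 'm) set \<Rightarrow> ('m \<times> 'm) set" where
  "pull_cong M m r =
     {(x, y) \<in> carrier M \<times> carrier M. (m \<otimes>\<^bsub>M\<^esub> x, m \<otimes>\<^bsub>M\<^esub> y) \<in> r}"


text \<open>
  The monoid \<open>L\<close> as the limit of the sets \<open>M / r\<close>, indexed by \<open>r\<close> in \<^const>\<open>cont_congs\<close>. For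
  \<open>r \<subseteq> s\<close> the transition map \<open>M / r \<rightarrow> M / s\<close> sends a class \<open>c\<close> to \<open>s `` c\<close>. In the product, the
  unions over representatives express that \<open>[a b]\<close> depends neither on the representative \<open>a\<close>
  of \<open>\<alpha> r\<close> nor on the representative \<open>b\<close> of \<open>\<beta> (a\<^sup>*(r))\<close>.
\<close>

definition endo_limit ::
    "('m, 'b) monoid_scheme \<Rightarrow> 'm topology \<Rightarrow> (('m \<times> 'm) set \<Rightarrow> 'm set) monoid" where
  "endo_limit M \<tau> =
     \<lparr> carrier = {\<alpha> \<in> (\<Pi>\<^sub>E r\<in>cont_congs M \<tau>. carrier M // r).
          \<forall>r\<in>cont_congs M \<tau>. \<forall>s\<in>cont_congs M \<tau>. r \<subseteq> s \<longrightarrow> s `` \<alpha> r = \<alpha> s},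
       mult = (\<lambda>\<alpha> \<beta>. \<lambda>r\<in>cont_congs M \<tau>.
          \<Union>a\<in>\<alpha> r. \<Union>b\<in>\<beta> (pull_cong M a r). r `` {a \<otimes>\<^bsub>M\<^esub> b}),
       one = (\<lambda>r\<in>cont_congs M \<tau>. r `` {\<one>\<^bsub>M\<^esub>}) \<rparr>"

definition endo_topology ::
    "('m, 'b) monoid_scheme \<Rightarrow> 'm topology \<Rightarrow> (('m \<times> 'm) set \<Rightarrow> 'm set) topology" where
  "endo_topology M \<tau> =
     topology_generated_by
       {{\<alpha> \<in> carrier (endo_limit M \<tau>). \<alpha> r \<in> S} | r S.
          r \<in> cont_congs M \<tau> \<and> S \<subseteq> carrier M // r}"

definition canonical_hom ::
    "('m, 'b) monoid_scheme \<Rightarrow> 'm topology \<Rightarrow> 'm \<Rightarrow> ('m \<times> 'm) set \<Rightarrow> 'm set" where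
  "canonical_hom M \<tau> m = (\<lambda>r\<in>cont_congs M \<tau>. r `` {m})"


text \<open>
  \<open>pull_set M p A\<close> is \<open>p\<^sup>*(A)\<close>, and \<open>same_pull M p A\<close> is the set \<open>I\<close> with lower index
  \<open>A\<close> and upper index \<open>p\<close>. In \<open>action_topology\<close>, the topology with the given base is the family of
  all unions of base members; equating this family with the open sets of \<open>\<tau>\<close> also makes it a
  topology.
\<close>

definition pull_set :: "('m, 'b) monoid_scheme \<Rightarrow> 'm \<Rightarrow> 'm set \<Rightarrow> 'm set" where
  "pull_set M p A = {m \<in> carrier M. p \<otimes>\<^bsub>M\<^esub> m \<in> A}"

definition same_pull :: "('m, 'b) monoid_scheme \<Rightarrow> 'm \<Rightarrow> 'm set \<Rightarrow> 'm set" where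
  "same_pull M p A = {m \<in> carrier M. pull_set M m A = pull_set M p A}"

definition action_topology :: "('m, 'b) monoid_scheme \<Rightarrow> 'm topology \<Rightarrow> bool" where
  "action_topology M \<tau> \<longleftrightarrow>
     openin \<tau> =
       arbitrary union_of (\<lambda>A. A \<subseteq> carrier M \<and>
         (\<forall>p\<in>carrier M. \<forall>q\<in>carrier M. openin \<tau> (same_pull M p (pull_set M q A))))"

definition powder_monoid :: "('m, 'b) monoid_scheme \<Rightarrow> 'm topology \<Rightarrow> bool" where
  "powder_monoid M \<tau> \<longleftrightarrow> topological_monoid M \<tau> \<and> t0_space \<tau> \<and> action_topology M \<tau>"


text \<open>
  The opposite of the monoid of natural endomorphisms of the forgetful functor, on the
  \<open>(M, \<tau>)\<close>-sets with elements in a given type \<open>'x\<close>. Endomorphisms are extended by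
  \<^const>\<open>undefined\<close> outside the objects and their carriers, so that equality is meaningful. The theorem
  \<open>endo_op_iso_limit\<close> below identifies this monoid with \<^const>\<open>endo_limit\<close>.
\<close>

definition endo_op ::
    "('m, 'b) monoid_scheme \<Rightarrow> 'm topology \<Rightarrow> ('x set \<Rightarrow> ('x \<Rightarrow> 'm \<Rightarrow> 'x) \<Rightarrow> 'x \<Rightarrow> 'x) monoid" where
  "endo_op M \<tau> =
     \<lparr> carrier = {\<phi>.
          (\<forall>X act. if continuous_M_set M \<tau> X act then \<phi> X act \<in> X \<rightarrow>\<^sub>E X
                   else \<phi> X act = (\<lambda>x. undefined)) \<and>
          (\<forall>X act Y act' f. continuous_M_set M \<tau> X act \<longrightarrow> continuous_M_set M \<tau> Y act' \<longrightarrow>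
             equivariant M X act Y act' f \<longrightarrow>
             (\<forall>x\<in>X. f (\<phi> X act x) = \<phi> Y act' (f x)))},
       mult = (\<lambda>\<phi> \<psi> X act. compose X (\<psi> X act) (\<phi> X act)),
       one = (\<lambda>X act. if continuous_M_set M \<tau> X act then (\<lambda>x\<in>X. x) else (\<lambda>x. undefined)) \<rparr>"


section \<open>Quotients and stabilisers\<close>

lemma right_congruenceD:
  assumes "right_congruence M r"
  shows "equiv (carrier M) r"
    and "(p, q) \<in> r \<Longrightarrow> m \<in> carrier M \<Longrightarrow> (p \<otimes>\<^bsub>M\<^esub> m, q \<otimes>\<^bsub>M\<^esub> m) \<in> r"
  using assms by (auto simp: right_congruence_def)

lemma cls_eq_iff:
  assumes "equiv A r" "a \<in> A" "b \<in> A"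
  shows "r `` {a} = r `` {b} \<longleftrightarrow> (a, b) \<in> r"
  using assms by (simp add: eq_equiv_class_iff)

lemma quot_act_cls:
  assumes "monoid M" "right_congruence M r" "a \<in> carrier M" "m \<in> carrier M"
  shows "quot_act M r (r `` {a}) m = r `` {a \<otimes>\<^bsub>M\<^esub> m}"
proof -
  have E: "equiv (carrier M) r" using assms right_congruenceD by blast
  have "r `` {b \<otimes>\<^bsub>M\<^esub> m} = r `` {a \<otimes>\<^bsub>M\<^esub> m}" if "b \<in> r `` {a}" for b
    using that right_congruenceD(2)[OF assms(2), of a b m] assms(4)
    by (metis E Image_singleton_iff equiv_class_eq)
  moreover have "a \<in> r `` {a}" using E assms(3) by (rule equiv_class_self)
  ultimately show ?thesis unfolding quot_act_def by blast
qed

lemma right_M_set_quot: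
  assumes "monoid M" "right_congruence M r"
  shows "right_M_set M (carrier M // r) (quot_act M r)"
proof -
  interpret monoid M by fact
  show ?thesis
    unfolding right_M_set_def
    by (auto elim!: quotientE simp: quot_act_cls assms m_assoc intro!: quotientI)
qed

lemma continuous_M_set_iff:
  assumes "right_M_set M X act" "topspace \<tau> = carrier M"
  shows "continuous_M_set M \<tau> X act \<longleftrightarrow>
    (\<forall>x\<in>X. \<forall>y\<in>X. openin \<tau> {m \<in> carrier M. act x m = y})"
proof
  assume L: "continuous_M_set M \<tau> X act"
  show "\<forall>x\<in>X. \<forall>y\<in>X. openin \<tau> {m \<in> carrier M. act x m = y}"
  proof (intro ballI)
    fix x y assume xy: "x \<in> X" "y \<in> X"
    have "continuous_map \<tau> (prod_topology (discrete_topology X) \<tau>) (\<lambda>m. (x, m))"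
      using xy by (intro continuous_map_pairedI) auto
    then have "continuous_map \<tau> (discrete_topology X) ((\<lambda>(x, m). act x m) \<circ> (\<lambda>m. (x, m)))"
      using L continuous_map_compose unfolding continuous_M_set_def by blast
    then have "continuous_map \<tau> (discrete_topology X) (act x)" by (simp add: o_def)
    from openin_continuous_map_preimage[OF this, of "{y}"] xy
    show "openin \<tau> {m \<in> carrier M. act x m = y}" by (simp add: assms(2))
  qed
next
  assume R: "\<forall>x\<in>X. \<forall>y\<in>X. openin \<tau> {m \<in> carrier M. act x m = y}"
  have "continuous_map (prod_topology (discrete_topology X) \<tau>) (discrete_topology X)
      (\<lambda>(x, m). act x m)"
    unfolding continuous_map_def
  proof (intro conjI allI impI)
    show "(\<lambda>(x, m). act x m)
        \<in> topspace (prod_topology (discrete_topology X) \<tau>) \<rightarrow> topspace (discrete_topology X)"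
      using assms by (auto simp: right_M_set_def)
    fix U assume U: "openin (discrete_topology X) U"
    let ?P = "{z \<in> topspace (prod_topology (discrete_topology X) \<tau>). (\<lambda>(x, m). act x m) z \<in> U}"
    show "openin (prod_topology (discrete_topology X) \<tau>) ?P"
      unfolding openin_prod_topology_alt
    proof (intro allI impI)
      fix x m assume "(x, m) \<in> ?P"
      then have x: "x \<in> X" "m \<in> carrier M" "act x m \<in> U" using assms by auto
      show "\<exists>V W. openin (discrete_topology X) V \<and> openin \<tau> W \<and> x \<in> V \<and> m \<in> W \<and> V \<times> W \<subseteq> ?P"
        using x U R assms
        by (intro exI[of _ "{x}"] exI[of _ "{n \<in> carrier M. act x n = act x m}"]) auto
    qed
  qed
  then show "continuous_M_set M \<tau> X act"
    using assms by (simp add: continuous_M_set_def)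
qed

lemma cont_congs_iff:
  assumes "monoid M" "topspace \<tau> = carrier M"
  shows "r \<in> cont_congs M \<tau> \<longleftrightarrow> right_congruence M r \<and>
    (\<forall>a\<in>carrier M. \<forall>b\<in>carrier M. openin \<tau> {m \<in> carrier M. (a \<otimes>\<^bsub>M\<^esub> m, b) \<in> r})"
proof (cases "right_congruence M r")
  case True
  interpret monoid M by fact
  have E: "equiv (carrier M) r" using True right_congruenceD by blast
  have eq: "{m \<in> carrier M. quot_act M r (r `` {a}) m = r `` {b}}
      = {m \<in> carrier M. (a \<otimes>\<^bsub>M\<^esub> m, b) \<in> r}" if "a \<in> carrier M" "b \<in> carrier M" for a b
    using that by (simp add: quot_act_cls assms True cls_eq_iff[OF E] cong: conj_cong)
  have "(\<forall>x\<in>carrier M // r. \<forall>y\<in>carrier M // r. openin \<tau> {m \<in> carrier M. quot_act M r x m = y})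
    \<longleftrightarrow> (\<forall>a\<in>carrier M. \<forall>b\<in>carrier M. openin \<tau> {m \<in> carrier M. (a \<otimes>\<^bsub>M\<^esub> m, b) \<in> r})"
    by (auto simp: quotient_def eq)
  then show ?thesis
    using True by (simp add: cont_congs_def continuous_M_set_iff[OF right_M_set_quot] assms)
qed (simp add: cont_congs_def)

lemma cont_congsD:
  assumes "r \<in> cont_congs M \<tau>"
  shows "right_congruence M r" "equiv (carrier M) r"
    "continuous_M_set M \<tau> (carrier M // r) (quot_act M r)"
  using assms right_congruenceD by (auto simp: cont_congs_def)

lemma pull_cong_cont:
  assumes "monoid M" "topspace \<tau> = carrier M" "r \<in> cont_congs M \<tau>" "a \<in> carrier M"
  shows "pull_cong M a r \<in> cont_congs M \<tau>"
proof -
  interpret monoid M by fact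
  have rc: "right_congruence M r" and E: "equiv (carrier M) r"
    and op: "\<And>a b. a \<in> carrier M \<Longrightarrow> b \<in> carrier M \<Longrightarrow>
      openin \<tau> {m \<in> carrier M. (a \<otimes>\<^bsub>M\<^esub> m, b) \<in> r}"
    using assms(3) by (simp_all add: cont_congs_iff[OF assms(1,2)] right_congruence_def)
  have "equiv (carrier M) (pull_cong M a r)"
  proof (rule equivI)
    show "pull_cong M a r \<subseteq> carrier M \<times> carrier M" by (auto simp: pull_cong_def)
    show "refl_on (carrier M) (pull_cong M a r)"
      using E assms(4) by (simp add: pull_cong_def equiv_def refl_on_def)
    show "sym (pull_cong M a r)"
      using E by (auto simp: pull_cong_def equiv_def sym_def)
    show "trans (pull_cong M a r)"
      using E unfolding pull_cong_def equiv_def trans_def by blast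
  qed
  moreover have "(p \<otimes>\<^bsub>M\<^esub> m, q \<otimes>\<^bsub>M\<^esub> m) \<in> pull_cong M a r"
    if "(p, q) \<in> pull_cong M a r" "m \<in> carrier M" for p q m
    using that right_congruenceD(2)[OF rc, of "a \<otimes>\<^bsub>M\<^esub> p" "a \<otimes>\<^bsub>M\<^esub> q" m] assms(4)
    by (auto simp: pull_cong_def m_assoc)
  ultimately have "right_congruence M (pull_cong M a r)"
    by (auto simp: right_congruence_def)
  moreover have "{m \<in> carrier M. (p \<otimes>\<^bsub>M\<^esub> m, q) \<in> pull_cong M a r}
      = {m \<in> carrier M. ((a \<otimes>\<^bsub>M\<^esub> p) \<otimes>\<^bsub>M\<^esub> m, a \<otimes>\<^bsub>M\<^esub> q) \<in> r}"
    if "p \<in> carrier M" "q \<in> carrier M" for p q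
    using that assms(4) by (auto simp: pull_cong_def m_assoc)
  ultimately show ?thesis
    using op assms(4) by (simp add: cont_congs_iff[OF assms(1,2)])
qed

lemma pull_cong_mult:
  assumes "monoid M" "a \<in> carrier M" "b \<in> carrier M"
  shows "pull_cong M (a \<otimes>\<^bsub>M\<^esub> b) r = pull_cong M b (pull_cong M a r)"
proof -
  interpret monoid M by fact
  show ?thesis using assms by (auto simp: pull_cong_def m_assoc)
qed

lemma pull_cong_one:
  assumes "monoid M" "equiv (carrier M) r"
  shows "pull_cong M \<one>\<^bsub>M\<^esub> r = r"
proof -
  interpret monoid M by fact
  show ?thesis using assms by (auto simp: pull_cong_def equiv_def)
qed

lemma pull_cong_rep:
  assumes "right_congruence M r" "(a, a') \<in> r"
  shows "pull_cong M a r = pull_cong M a' r"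
proof -
  have "sym r" "trans r" using assms by (auto simp: right_congruence_def equiv_def)
  have 1: "(a \<otimes>\<^bsub>M\<^esub> x, a' \<otimes>\<^bsub>M\<^esub> x) \<in> r" if "x \<in> carrier M" for x
    by (rule right_congruenceD(2)[OF assms that])
  have "(a \<otimes>\<^bsub>M\<^esub> x, a \<otimes>\<^bsub>M\<^esub> y) \<in> r \<longleftrightarrow> (a' \<otimes>\<^bsub>M\<^esub> x, a' \<otimes>\<^bsub>M\<^esub> y) \<in> r"
    if "x \<in> carrier M" "y \<in> carrier M" for x y
    using 1[OF that(1)] 1[OF that(2)] \<open>sym r\<close> \<open>trans r\<close> by (meson symD transD)
  then show ?thesis by (auto simp: pull_cong_def)
qed

definition stab_cong :: "('m, 'b) monoid_scheme \<Rightarrow> ('x \<Rightarrow> 'm \<Rightarrow> 'x) \<Rightarrow> 'x \<Rightarrow> ('m \<times> 'm) set" where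
  "stab_cong M act x = {(m, n) \<in> carrier M \<times> carrier M. act x m = act x n}"

lemma stab_cong_cont:
  assumes "monoid M" "topspace \<tau> = carrier M" "continuous_M_set M \<tau> X act" "x \<in> X"
  shows "stab_cong M act x \<in> cont_congs M \<tau>"
proof -
  interpret monoid M by fact
  have S: "right_M_set M X act" using assms by (simp add: continuous_M_set_def)
  note op = continuous_M_set_iff[OF S assms(2), THEN iffD1, OF assms(3), rule_format]
  have A: "act x m \<in> X" "act (act x m) n = act x (m \<otimes>\<^bsub>M\<^esub> n)"
    if "m \<in> carrier M" "n \<in> carrier M" for m n
    using S assms(4) that by (auto simp: right_M_set_def)
  have "right_congruence M (stab_cong M act x)"
    unfolding right_congruence_def
  proof (intro conjI allI ballI impI)
    show "equiv (carrier M) (stab_cong M act x)"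
      by (auto simp: equiv_def refl_on_def sym_def trans_def stab_cong_def)
    fix p q m assume "m \<in> carrier M" "(p, q) \<in> stab_cong M act x"
    then show "(p \<otimes>\<^bsub>M\<^esub> m, q \<otimes>\<^bsub>M\<^esub> m) \<in> stab_cong M act x"
      using A(2)[of p m] A(2)[of q m] by (auto simp: stab_cong_def)
  qed
  moreover have "{m \<in> carrier M. (p \<otimes>\<^bsub>M\<^esub> m, q) \<in> stab_cong M act x}
      = {m \<in> carrier M. act (act x p) m = act x q}"
    if "p \<in> carrier M" "q \<in> carrier M" for p q
    using that A by (auto simp: stab_cong_def)
  ultimately show ?thesis
    using op A by (simp add: cont_congs_iff[OF assms(1,2)])
qed

lemma stab_cong_cls:
  assumes "monoid M" "r \<in> cont_congs M \<tau>" "a \<in> carrier M"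
  shows "stab_cong M (quot_act M r) (r `` {a}) = pull_cong M a r"
proof -
  interpret monoid M by fact
  show ?thesis
    using assms(3) unfolding stab_cong_def pull_cong_def
    by (intro Collect_cong)
      (simp add: quot_act_cls[OF assms(1) cont_congsD(1)[OF assms(2)]]
        cls_eq_iff[OF cont_congsD(2)[OF assms(2)]] split: prod.split cong: conj_cong)
qed


section \<open>The limit is a topological monoid\<close>

lemma limit_cls:
  assumes "\<alpha> \<in> carrier (endo_limit M \<tau>)" "r \<in> cont_congs M \<tau>" "a \<in> \<alpha> r"
  shows "a \<in> carrier M" "\<alpha> r = r `` {a}"
proof -
  have "\<alpha> r \<in> carrier M // r" using assms by (auto simp: endo_limit_def)
  then obtain b where b: "b \<in> carrier M" "\<alpha> r = r `` {b}" by (auto elim: quotientE)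
  have E: "equiv (carrier M) r" using assms cont_congsD by blast
  have "(b, a) \<in> r" using b assms by auto
  with E b show "a \<in> carrier M" "\<alpha> r = r `` {a}"
    by (auto simp: equiv_def dest: equiv_class_eq[OF E])
qed

lemma limit_rep:
  assumes "\<alpha> \<in> carrier (endo_limit M \<tau>)" "r \<in> cont_congs M \<tau>"
  obtains a where "a \<in> \<alpha> r" "a \<in> carrier M" "\<alpha> r = r `` {a}"
proof -
  have "\<alpha> r \<in> carrier M // r" using assms by (auto simp: endo_limit_def)
  then obtain b where b: "b \<in> carrier M" "\<alpha> r = r `` {b}" by (auto elim: quotientE)
  with that show ?thesis
    using assms cont_congsD(2)[OF assms(2)] by (metis equiv_class_self)
qed

lemma limit_mono:
  assumes "\<alpha> \<in> carrier (endo_limit M \<tau>)" "r \<in> cont_congs M \<tau>" "s \<in> cont_congs M \<tau>" "r \<subseteq> s"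
    "a \<in> \<alpha> r"
  shows "a \<in> \<alpha> s"
proof -
  have "s `` \<alpha> r = \<alpha> s" using assms by (auto simp: endo_limit_def)
  moreover have "(a, a) \<in> s"
    using limit_cls(1)[OF assms(1,2,5)] cont_congsD(2)[OF assms(3)]
    by (auto simp: equiv_def refl_on_def)
  ultimately show ?thesis using assms(5) by auto
qed

lemma limitI:
  assumes "\<alpha> \<in> extensional (cont_congs M \<tau>)"
    and "\<And>r. r \<in> cont_congs M \<tau> \<Longrightarrow> \<exists>a\<in>carrier M. \<alpha> r = r `` {a}"
    and "\<And>r s. r \<in> cont_congs M \<tau> \<Longrightarrow> s \<in> cont_congs M \<tau> \<Longrightarrow> r \<subseteq> s \<Longrightarrow> \<alpha> r \<inter> \<alpha> s \<noteq> {}"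
  shows "\<alpha> \<in> carrier (endo_limit M \<tau>)"
proof -
  have "s `` \<alpha> r = \<alpha> s" if rs: "r \<in> cont_congs M \<tau>" "s \<in> cont_congs M \<tau>" "r \<subseteq> s" for r s
  proof -
    obtain c where c: "c \<in> \<alpha> r" "c \<in> \<alpha> s" using assms(3)[OF rs] by blast
    obtain a b where ab: "\<alpha> r = r `` {a}" "\<alpha> s = s `` {b}" using assms(2) rs by meson
    have E: "equiv (carrier M) r" "equiv (carrier M) s" using rs cont_congsD by blast+
    have "\<alpha> r = r `` {c}" "\<alpha> s = s `` {c}"
      using ab c equiv_class_eq[OF E(1)] equiv_class_eq[OF E(2)] by blast+
    moreover have "s `` (r `` {c}) = s `` {c}"
    proof -
      have "(c, c) \<in> r" using c ab E(1) unfolding equiv_def refl_on_def by blast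
      moreover have "trans s" using E(2) by (simp add: equiv_def)
      ultimately show ?thesis using rs(3) by (auto dest: transD)
    qed
    ultimately show ?thesis by simp
  qed
  then show ?thesis
    using assms(1,2) by (force simp: endo_limit_def PiE_def intro: quotientI)
qed

lemma limit_mult:
  assumes "monoid M" "topspace \<tau> = carrier M"
    and "\<alpha> \<in> carrier (endo_limit M \<tau>)" "\<beta> \<in> carrier (endo_limit M \<tau>)" "r \<in> cont_congs M \<tau>"
    and "a \<in> \<alpha> r" "b \<in> \<beta> (pull_cong M a r)"
  shows "(\<alpha> \<otimes>\<^bsub>endo_limit M \<tau>\<^esub> \<beta>) r = r `` {a \<otimes>\<^bsub>M\<^esub> b}"
proof -
  interpret monoid M by fact
  note a = limit_cls[OF assms(3,5,6)]
  note rc = cont_congsD(1,2)[OF assms(5)]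
  note p = pull_cong_cont[OF assms(1,2,5) a(1)]
  note b = limit_cls[OF assms(4) p assms(7)]
  have "r `` {a' \<otimes>\<^bsub>M\<^esub> b'} = r `` {a \<otimes>\<^bsub>M\<^esub> b}"
    if a': "a' \<in> \<alpha> r" and b': "b' \<in> \<beta> (pull_cong M a' r)" for a' b'
  proof -
    have aa: "(a, a') \<in> r" using a a' by auto
    then have "b' \<in> \<beta> (pull_cong M a r)" using b' pull_cong_rep[OF rc(1)] by metis
    then have "(b, b') \<in> pull_cong M a r" using b by auto
    then have 1: "(a \<otimes>\<^bsub>M\<^esub> b, a \<otimes>\<^bsub>M\<^esub> b') \<in> r" and "b' \<in> carrier M" by (auto simp: pull_cong_def)
    then have "(a \<otimes>\<^bsub>M\<^esub> b', a' \<otimes>\<^bsub>M\<^esub> b') \<in> r" using aa right_congruenceD(2)[OF rc(1)] by blast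
    with 1 show ?thesis using equiv_class_eq[OF rc(2)] by metis
  qed
  then have "(\<Union>a\<in>\<alpha> r. \<Union>b\<in>\<beta> (pull_cong M a r). r `` {a \<otimes>\<^bsub>M\<^esub> b}) = r `` {a \<otimes>\<^bsub>M\<^esub> b}"
    using assms(6,7) by blast
  then show ?thesis using assms(5) by (simp add: endo_limit_def)
qed

lemma limit_mult_mem:
  assumes "monoid M" "topspace \<tau> = carrier M"
    and "\<alpha> \<in> carrier (endo_limit M \<tau>)" "\<beta> \<in> carrier (endo_limit M \<tau>)" "r \<in> cont_congs M \<tau>"
    and "a \<in> \<alpha> r" "b \<in> \<beta> (pull_cong M a r)"
  shows "a \<otimes>\<^bsub>M\<^esub> b \<in> (\<alpha> \<otimes>\<^bsub>endo_limit M \<tau>\<^esub> \<beta>) r"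
proof -
  interpret monoid M by fact
  note a = limit_cls[OF assms(3,5,6)]
  note b = limit_cls[OF assms(4) pull_cong_cont[OF assms(1,2,5) a(1)] assms(7)]
  show ?thesis
    using limit_mult[OF assms] a b equiv_class_self[OF cont_congsD(2)[OF assms(5)]] by simp
qed

lemma limit_eqI:
  assumes "\<alpha> \<in> carrier (endo_limit M \<tau>)" "\<beta> \<in> carrier (endo_limit M \<tau>)"
    and "\<And>r. r \<in> cont_congs M \<tau> \<Longrightarrow> \<alpha> r \<inter> \<beta> r \<noteq> {}"
  shows "\<alpha> = \<beta>"
proof
  fix r
  show "\<alpha> r = \<beta> r"
  proof (cases "r \<in> cont_congs M \<tau>")
    case True
    then obtain c where "c \<in> \<alpha> r" "c \<in> \<beta> r" using assms(3) by blast
    then show ?thesis using limit_cls(2)[OF assms(1) True] limit_cls(2)[OF assms(2) True] by metis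
  next
    case False
    then show ?thesis using assms(1,2) by (auto simp: endo_limit_def PiE_def extensional_def)
  qed
qed

lemma limit_mult_closed:
  assumes "monoid M" "topspace \<tau> = carrier M"
    and "\<alpha> \<in> carrier (endo_limit M \<tau>)" "\<beta> \<in> carrier (endo_limit M \<tau>)"
  shows "\<alpha> \<otimes>\<^bsub>endo_limit M \<tau>\<^esub> \<beta> \<in> carrier (endo_limit M \<tau>)"
proof (rule limitI)
  interpret monoid M by fact
  show "\<alpha> \<otimes>\<^bsub>endo_limit M \<tau>\<^esub> \<beta> \<in> extensional (cont_congs M \<tau>)" by (simp add: endo_limit_def)
  note pc = pull_cong_cont[OF assms(1,2)]
  show "\<exists>c\<in>carrier M. (\<alpha> \<otimes>\<^bsub>endo_limit M \<tau>\<^esub> \<beta>) r = r `` {c}" if r: "r \<in> cont_congs M \<tau>" for r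
  proof -
    obtain a where a: "a \<in> \<alpha> r" "a \<in> carrier M" using limit_rep[OF assms(3) r] by blast
    obtain b where b: "b \<in> \<beta> (pull_cong M a r)" "b \<in> carrier M"
      using limit_rep[OF assms(4) pc[OF r a(2)]] by blast
    show ?thesis using limit_mult[OF assms r a(1) b(1)] a b by blast
  qed
  show "(\<alpha> \<otimes>\<^bsub>endo_limit M \<tau>\<^esub> \<beta>) r \<inter> (\<alpha> \<otimes>\<^bsub>endo_limit M \<tau>\<^esub> \<beta>) s \<noteq> {}"
    if rs: "r \<in> cont_congs M \<tau>" "s \<in> cont_congs M \<tau>" "r \<subseteq> s" for r s
  proof -
    obtain a where a: "a \<in> \<alpha> r" "a \<in> carrier M" using limit_rep[OF assms(3) rs(1)] by blast
    obtain b where b: "b \<in> \<beta> (pull_cong M a r)"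
      using limit_rep[OF assms(4) pc[OF rs(1) a(2)]] by blast
    have "pull_cong M a r \<subseteq> pull_cong M a s" using rs(3) by (auto simp: pull_cong_def)
    then have "b \<in> \<beta> (pull_cong M a s)"
      using limit_mono[OF assms(4) pc[OF rs(1) a(2)] pc[OF rs(2) a(2)]] b by blast
    then show ?thesis
      using limit_mult_mem[OF assms rs(1) a(1) b]
        limit_mult_mem[OF assms rs(2) limit_mono[OF assms(3) rs a(1)]] by blast
  qed
qed

lemma limit_one_closed:
  assumes "monoid M"
  shows "\<one>\<^bsub>endo_limit M \<tau>\<^esub> \<in> carrier (endo_limit M \<tau>)"
proof (rule limitI)
  interpret monoid M by fact
  show "\<one>\<^bsub>endo_limit M \<tau>\<^esub> \<in> extensional (cont_congs M \<tau>)" by (simp add: endo_limit_def)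
  show "\<exists>a\<in>carrier M. \<one>\<^bsub>endo_limit M \<tau>\<^esub> r = r `` {a}" if "r \<in> cont_congs M \<tau>" for r
    using that by (auto simp: endo_limit_def)
  show "\<one>\<^bsub>endo_limit M \<tau>\<^esub> r \<inter> \<one>\<^bsub>endo_limit M \<tau>\<^esub> s \<noteq> {}"
    if "r \<in> cont_congs M \<tau>" "s \<in> cont_congs M \<tau>" "r \<subseteq> s" for r s
    using that equiv_class_self[OF cont_congsD(2), of _ M \<tau> "\<one>\<^bsub>M\<^esub>"]
    by (auto simp: endo_limit_def)
qed

lemma monoid_endo_limit:
  assumes "monoid M" "topspace \<tau> = carrier M"
  shows "monoid (endo_limit M \<tau>)"
proof (rule monoidI)
  interpret monoid M by fact
  note pc = pull_cong_cont[OF assms]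
  note mem = limit_mult_mem[OF assms]
  note cl = limit_mult_closed[OF assms]
  have one: "\<one>\<^bsub>M\<^esub> \<in> \<one>\<^bsub>endo_limit M \<tau>\<^esub> r" if "r \<in> cont_congs M \<tau>" for r
    using that equiv_class_self[OF cont_congsD(2), of _ M \<tau> "\<one>\<^bsub>M\<^esub>"] by (simp add: endo_limit_def)
  let ?L = "endo_limit M \<tau>"
  show "\<one>\<^bsub>?L\<^esub> \<in> carrier ?L" by (rule limit_one_closed) fact
  show "x \<otimes>\<^bsub>?L\<^esub> y \<in> carrier ?L" if "x \<in> carrier ?L" "y \<in> carrier ?L" for x y
    using that by (rule cl)
  show "x \<otimes>\<^bsub>?L\<^esub> y \<otimes>\<^bsub>?L\<^esub> z = x \<otimes>\<^bsub>?L\<^esub> (y \<otimes>\<^bsub>?L\<^esub> z)"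
    if x: "x \<in> carrier ?L" and y: "y \<in> carrier ?L" and z: "z \<in> carrier ?L" for x y z
  proof (rule limit_eqI)
    show "x \<otimes>\<^bsub>?L\<^esub> y \<otimes>\<^bsub>?L\<^esub> z \<in> carrier ?L" "x \<otimes>\<^bsub>?L\<^esub> (y \<otimes>\<^bsub>?L\<^esub> z) \<in> carrier ?L"
      using x y z cl by blast+
    fix r assume r: "r \<in> cont_congs M \<tau>"
    obtain a where a: "a \<in> x r" "a \<in> carrier M" using limit_rep[OF x r] by blast
    obtain b where b: "b \<in> y (pull_cong M a r)" "b \<in> carrier M"
      using limit_rep[OF y pc[OF r a(2)]] by blast
    obtain c where c: "c \<in> z (pull_cong M (a \<otimes>\<^bsub>M\<^esub> b) r)" "c \<in> carrier M"
      using limit_rep[OF z pc[OF r]] a b by blast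
    have c': "c \<in> z (pull_cong M b (pull_cong M a r))"
      using c pull_cong_mult[OF assms(1) a(2) b(2)] by metis
    have "a \<otimes>\<^bsub>M\<^esub> b \<otimes>\<^bsub>M\<^esub> c \<in> (x \<otimes>\<^bsub>?L\<^esub> y \<otimes>\<^bsub>?L\<^esub> z) r"
      using mem[OF cl[OF x y] z r mem[OF x y r a(1) b(1)] c(1)] .
    moreover have "a \<otimes>\<^bsub>M\<^esub> (b \<otimes>\<^bsub>M\<^esub> c) \<in> (x \<otimes>\<^bsub>?L\<^esub> (y \<otimes>\<^bsub>?L\<^esub> z)) r"
      using mem[OF x cl[OF y z] r a(1) mem[OF y z pc[OF r a(2)] b(1) c']] .
    ultimately show "(x \<otimes>\<^bsub>?L\<^esub> y \<otimes>\<^bsub>?L\<^esub> z) r \<inter> (x \<otimes>\<^bsub>?L\<^esub> (y \<otimes>\<^bsub>?L\<^esub> z)) r \<noteq> {}"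
      using m_assoc[OF a(2) b(2) c(2)] by auto
  qed
  show "\<one>\<^bsub>?L\<^esub> \<otimes>\<^bsub>?L\<^esub> x = x" if x: "x \<in> carrier ?L" for x
  proof (rule limit_eqI)
    show "\<one>\<^bsub>?L\<^esub> \<otimes>\<^bsub>?L\<^esub> x \<in> carrier ?L" "x \<in> carrier ?L"
      using x cl limit_one_closed[OF assms(1)] by blast+
    fix r assume r: "r \<in> cont_congs M \<tau>"
    obtain a where a: "a \<in> x r" "a \<in> carrier M" using limit_rep[OF x r] by blast
    have "a \<in> x (pull_cong M \<one>\<^bsub>M\<^esub> r)"
      using a pull_cong_one[OF assms(1) cont_congsD(2)[OF r]] by metis
    from mem[OF limit_one_closed[OF assms(1)] x r one[OF r] this]
    show "(\<one>\<^bsub>?L\<^esub> \<otimes>\<^bsub>?L\<^esub> x) r \<inter> x r \<noteq> {}" using a by auto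
  qed
  show "x \<otimes>\<^bsub>?L\<^esub> \<one>\<^bsub>?L\<^esub> = x" if x: "x \<in> carrier ?L" for x
  proof (rule limit_eqI)
    show "x \<otimes>\<^bsub>?L\<^esub> \<one>\<^bsub>?L\<^esub> \<in> carrier ?L" "x \<in> carrier ?L"
      using x cl limit_one_closed[OF assms(1)] by blast+
    fix r assume r: "r \<in> cont_congs M \<tau>"
    obtain a where a: "a \<in> x r" "a \<in> carrier M" using limit_rep[OF x r] by blast
    from mem[OF x limit_one_closed[OF assms(1)] r a(1) one[OF pc[OF r a(2)]]]
    show "(x \<otimes>\<^bsub>?L\<^esub> \<one>\<^bsub>?L\<^esub>) r \<inter> x r \<noteq> {}" using a by auto
  qed
qed

lemma topspace_endo_topology:
  assumes "monoid M" "topspace \<tau> = carrier M"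
  shows "topspace (endo_topology M \<tau>) = carrier (endo_limit M \<tau>)"
proof -
  interpret monoid M by fact
  have "right_congruence M (carrier M \<times> carrier M)"
    by (auto simp: right_congruence_def equiv_def refl_on_def sym_def trans_def)
  then have R: "carrier M \<times> carrier M \<in> cont_congs M \<tau>"
    using openin_topspace[of \<tau>] by (simp add: cont_congs_iff[OF assms] assms(2) cong: conj_cong)
  have "\<alpha> (carrier M \<times> carrier M) \<in> carrier M // (carrier M \<times> carrier M)"
    if "\<alpha> \<in> carrier (endo_limit M \<tau>)" for \<alpha>
    using that R by (auto simp: endo_limit_def)
  then show ?thesis
    using R unfolding endo_topology_def topology_generated_by_topspace by blast
qed

theorem topological_monoid_endo_limit:
  assumes "topological_monoid M \<tau>"
  shows "topological_monoid (endo_limit M \<tau>) (endo_topology M \<tau>)"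
proof -
  have M: "monoid M" "topspace \<tau> = carrier M" using assms by (auto simp: topological_monoid_def)
  note ts = topspace_endo_topology[OF M]
  let ?L = "endo_limit M \<tau>" and ?\<rho> = "endo_topology M \<tau>"
  have sub: "openin ?\<rho> {\<alpha> \<in> carrier ?L. \<alpha> r \<in> S}"
    if "r \<in> cont_congs M \<tau>" "S \<subseteq> carrier M // r" for r S
    using that unfolding endo_topology_def by (intro topology_generated_by_Basis) blast
  have "continuous_map (prod_topology ?\<rho> ?\<rho>)
      (topology_generated_by {{\<alpha> \<in> carrier ?L. \<alpha> r \<in> S} | r S.
          r \<in> cont_congs M \<tau> \<and> S \<subseteq> carrier M // r}) (\<lambda>(x, y). x \<otimes>\<^bsub>?L\<^esub> y)"
  proof (rule continuous_on_generated_topo)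
    fix U assume "U \<in> {{\<alpha> \<in> carrier ?L. \<alpha> r \<in> S} | r S.
          r \<in> cont_congs M \<tau> \<and> S \<subseteq> carrier M // r}"
    then obtain r S where U: "U = {\<alpha> \<in> carrier ?L. \<alpha> r \<in> S}" "r \<in> cont_congs M \<tau>"
        "S \<subseteq> carrier M // r" by blast
    show "openin (prod_topology ?\<rho> ?\<rho>)
        ((\<lambda>(x, y). x \<otimes>\<^bsub>?L\<^esub> y) -` U \<inter> topspace (prod_topology ?\<rho> ?\<rho>))" (is "openin _ ?P")
      unfolding openin_prod_topology_alt
    proof (intro allI impI)
      fix x y assume "(x, y) \<in> ?P"
      then have x: "x \<in> carrier ?L" and y: "y \<in> carrier ?L" and S: "(x \<otimes>\<^bsub>?L\<^esub> y) r \<in> S"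
        by (auto simp: ts U)
      obtain a where a: "a \<in> x r" "a \<in> carrier M" using limit_rep[OF x U(2)] by blast
      let ?s = "pull_cong M a r"
      have s: "?s \<in> cont_congs M \<tau>" by (rule pull_cong_cont[OF M U(2) a(2)])
      obtain b where b: "b \<in> y ?s" using limit_rep[OF y s] by blast
      let ?V = "{\<alpha> \<in> carrier ?L. \<alpha> r \<in> {x r}}" and ?W = "{\<alpha> \<in> carrier ?L. \<alpha> ?s \<in> {y ?s}}"
      have "x r \<in> carrier M // r" "y ?s \<in> carrier M // ?s"
        using x y U(2) s by (auto simp: endo_limit_def)
      then have "openin ?\<rho> ?V" "openin ?\<rho> ?W"
        using sub[OF U(2), of "{x r}"] sub[OF s, of "{y ?s}"] by blast+
      moreover have "?V \<times> ?W \<subseteq> ?P"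
      proof safe
        fix x' y'
        assume *: "x' \<in> carrier ?L" "x' r = x r" "y' \<in> carrier ?L" "y' ?s = y ?s"
        have "(x' \<otimes>\<^bsub>?L\<^esub> y') r = r `` {a \<otimes>\<^bsub>M\<^esub> b}"
          using limit_mult[OF M *(1,3) U(2)] * a b by simp
        also have "\<dots> = (x \<otimes>\<^bsub>?L\<^esub> y) r" using limit_mult[OF M x y U(2) a(1) b] by simp
        finally show "(x', y') \<in> (\<lambda>(x, y). x \<otimes>\<^bsub>?L\<^esub> y) -` U"
          using S limit_mult_closed[OF M *(1,3)] by (simp add: U)
      qed (auto simp: ts)
      ultimately show "\<exists>V W. openin ?\<rho> V \<and> openin ?\<rho> W \<and> x \<in> V \<and> y \<in> W \<and> V \<times> W \<subseteq> ?P"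
        using x y by (intro exI[of _ ?V] exI[of _ ?W]) auto
    qed
  next
    have "\<Union> {{\<alpha> \<in> carrier ?L. \<alpha> r \<in> S} | r S. r \<in> cont_congs M \<tau> \<and> S \<subseteq> carrier M // r}
        = carrier ?L"
      using ts unfolding endo_topology_def topology_generated_by_topspace .
    then show "(\<lambda>(x, y). x \<otimes>\<^bsub>?L\<^esub> y) ` topspace (prod_topology ?\<rho> ?\<rho>) \<subseteq>
        \<Union> {{\<alpha> \<in> carrier ?L. \<alpha> r \<in> S} | r S. r \<in> cont_congs M \<tau> \<and> S \<subseteq> carrier M // r}"
      using limit_mult_closed[OF M] by (auto simp: ts simp del: Union_iff)
  qed
  then show ?thesis
    using monoid_endo_limit[OF M] ts by (simp add: topological_monoid_def endo_topology_def)
qed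


section \<open>The limit is the opposite of the endomorphism monoid\<close>

definition endo_tuple ::
    "('m, 'b) monoid_scheme \<Rightarrow> 'm topology
      \<Rightarrow> ('m set set \<Rightarrow> ('m set \<Rightarrow> 'm \<Rightarrow> 'm set) \<Rightarrow> 'm set \<Rightarrow> 'm set)
      \<Rightarrow> ('m \<times> 'm) set \<Rightarrow> 'm set" where
  "endo_tuple M \<tau> \<phi> =
     (\<lambda>r\<in>cont_congs M \<tau>. \<phi> (carrier M // r) (quot_act M r) (r `` {\<one>\<^bsub>M\<^esub>}))"

lemma endo_op_natural:
  assumes "\<phi> \<in> carrier (endo_op M \<tau>)" "continuous_M_set M \<tau> X act"
    "continuous_M_set M \<tau> Y act'" "equivariant M X act Y act' f" "x \<in> X"
  shows "\<phi> Y act' (f x) = f (\<phi> X act x)"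
  using assms by (simp add: endo_op_def)

lemma endo_op_maps:
  assumes "\<phi> \<in> carrier (endo_op M \<tau>)" "continuous_M_set M \<tau> X act"
  shows "\<phi> X act \<in> X \<rightarrow>\<^sub>E X"
  using assms unfolding endo_op_def by (simp add: if_splits)

lemma endo_tuple_limit:
  assumes "monoid M" "topspace \<tau> = carrier M" "\<phi> \<in> carrier (endo_op M \<tau>)"
  shows "endo_tuple M \<tau> \<phi> \<in> carrier (endo_limit M \<tau>)"
proof (rule limitI)
  interpret monoid M by fact
  show "endo_tuple M \<tau> \<phi> \<in> extensional (cont_congs M \<tau>)" by (simp add: endo_tuple_def)
  have mem: "endo_tuple M \<tau> \<phi> r \<in> carrier M // r" if r: "r \<in> cont_congs M \<tau>" for r
    using endo_op_maps[OF assms(3) cont_congsD(3)[OF r]] r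
    by (auto simp: endo_tuple_def intro: quotientI)
  then show "\<exists>a\<in>carrier M. endo_tuple M \<tau> \<phi> r = r `` {a}" if "r \<in> cont_congs M \<tau>" for r
    using that by (metis quotientE)
  show "endo_tuple M \<tau> \<phi> r \<inter> endo_tuple M \<tau> \<phi> s \<noteq> {}"
    if rs: "r \<in> cont_congs M \<tau>" "s \<in> cont_congs M \<tau>" "r \<subseteq> s" for r s
  proof -
    note Er = cont_congsD(2)[OF rs(1)] and Es = cont_congsD(2)[OF rs(2)]
    have img: "s `` (r `` {a}) = s `` {a}" if "a \<in> carrier M" for a
    proof -
      have "(a, a) \<in> r" using Er that by (auto simp: equiv_def refl_on_def)
      moreover have "trans s" using Es by (auto simp: equiv_def)
      ultimately show ?thesis using rs(3) by (auto dest: transD)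
    qed
    have eqv: "equivariant M (carrier M // r) (quot_act M r) (carrier M // s) (quot_act M s)
        (\<lambda>c. s `` c)"
      unfolding equivariant_def
    proof (intro conjI ballI funcsetI)
      fix c assume "c \<in> carrier M // r"
      then obtain a where a: "a \<in> carrier M" "c = r `` {a}" by (rule quotientE)
      then show "s `` c \<in> carrier M // s" using img[OF a(1)] by (simp add: quotientI)
      fix m assume m: "m \<in> carrier M"
      have "a \<otimes>\<^bsub>M\<^esub> m \<in> carrier M" using a m by simp
      then show "s `` quot_act M r c m = quot_act M s (s `` c) m"
        using a m img quot_act_cls[OF assms(1) cont_congsD(1)[OF rs(1)] a(1) m]
          quot_act_cls[OF assms(1) cont_congsD(1)[OF rs(2)] a(1) m] by metis
    qed
    have "endo_tuple M \<tau> \<phi> s = s `` endo_tuple M \<tau> \<phi> r"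
      using endo_op_natural[OF assms(3) cont_congsD(3)[OF rs(1)] cont_congsD(3)[OF rs(2)] eqv,
          of "r `` {\<one>\<^bsub>M\<^esub>}"] rs img by (simp add: endo_tuple_def quotientI)
    moreover obtain a where a: "a \<in> carrier M" "endo_tuple M \<tau> \<phi> r = r `` {a}"
      using mem[OF rs(1)] by (metis quotientE)
    ultimately have "endo_tuple M \<tau> \<phi> s = s `` {a}" using img by metis
    then show ?thesis
      using a equiv_class_self[OF Er a(1)] equiv_class_self[OF Es a(1)] by auto
  qed
qed

lemma endo_op_eval:
  fixes \<phi> :: "'m set set \<Rightarrow> ('m set \<Rightarrow> 'm \<Rightarrow> 'm set) \<Rightarrow> 'm set \<Rightarrow> 'm set"
  assumes "monoid M" "topspace \<tau> = carrier M" "\<phi> \<in> carrier (endo_op M \<tau>)"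
    and "continuous_M_set M \<tau> X act" "x \<in> X" "a \<in> endo_tuple M \<tau> \<phi> (stab_cong M act x)"
  shows "\<phi> X act x = act x a"
proof -
  interpret monoid M by fact
  let ?r = "stab_cong M act x"
  have r: "?r \<in> cont_congs M \<tau>" by (rule stab_cong_cont[OF assms(1,2,4,5)])
  note rc = cont_congsD[OF r]
  have S: "right_M_set M X act" using assms by (simp add: continuous_M_set_def)
  note L = endo_tuple_limit[OF assms(1,2,3)]
  note a = limit_cls[OF L r assms(6)]
  define f where "f c = act x (SOME m. m \<in> c)" for c
  have f: "f (?r `` {m}) = act x m" if "m \<in> carrier M" for m
  proof -
    have "(SOME n. n \<in> ?r `` {m}) \<in> ?r `` {m}"
      using equiv_class_self[OF rc(2) that] by (rule someI)
    then have "act x m = act x (SOME n. n \<in> ?r `` {m})"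
      unfolding Image_singleton_iff by (simp only: stab_cong_def mem_Collect_eq prod.case)
    then show ?thesis by (simp only: f_def)
  qed
  have eqv: "equivariant M (carrier M // ?r) (quot_act M ?r) X act f"
    unfolding equivariant_def
  proof (intro conjI ballI funcsetI)
    fix c assume "c \<in> carrier M // ?r"
    then obtain b where b: "b \<in> carrier M" "c = ?r `` {b}" by (rule quotientE)
    then show "f c \<in> X" using f S assms(5) by (simp only: right_M_set_def)
    fix m assume m: "m \<in> carrier M"
    have "f (quot_act M ?r c m) = act x (b \<otimes>\<^bsub>M\<^esub> m)"
      using quot_act_cls[OF assms(1) rc(1) b(1) m] f[of "b \<otimes>\<^bsub>M\<^esub> m"] b m by simp
    also have "\<dots> = act (act x b) m" using S assms(5) b m by (simp add: right_M_set_def)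
    finally show "f (quot_act M ?r c m) = act (f c) m" using f b by simp
  qed
  have "\<phi> X act (f (?r `` {\<one>\<^bsub>M\<^esub>})) = f (\<phi> (carrier M // ?r) (quot_act M ?r) (?r `` {\<one>\<^bsub>M\<^esub>}))"
    by (rule endo_op_natural[OF assms(3) rc(3) assms(4) eqv]) (simp add: quotientI)
  also have "\<phi> (carrier M // ?r) (quot_act M ?r) (?r `` {\<one>\<^bsub>M\<^esub>}) = ?r `` {a}"
    using a(2) r by (simp only: endo_tuple_def restrict_apply if_True)
  finally have "\<phi> X act (act x \<one>\<^bsub>M\<^esub>) = act x a"
    by (simp only: f[OF one_closed] f[OF a(1)])
  then show ?thesis using S assms(5) by (simp add: right_M_set_def)
qed

theorem endo_op_iso_limit:
  fixes M :: "('m, 'b) monoid_scheme"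
  assumes "topological_monoid M \<tau>"
  shows "endo_tuple M \<tau> \<in> iso (endo_op M \<tau>) (endo_limit M \<tau>)"
proof -
  have M: "monoid M" "topspace \<tau> = carrier M" using assms by (auto simp: topological_monoid_def)
  interpret monoid M by fact
  let ?E = "endo_op M \<tau>
    :: ('m set set \<Rightarrow> ('m set \<Rightarrow> 'm \<Rightarrow> 'm set) \<Rightarrow> 'm set \<Rightarrow> 'm set) monoid"
  let ?L = "endo_limit M \<tau>" and ?T = "endo_tuple M \<tau>"
  note lim = endo_tuple_limit[OF M] and ev = endo_op_eval[OF M]
  have mcl: "\<phi> \<otimes>\<^bsub>?E\<^esub> \<psi> \<in> carrier ?E" if p: "\<phi> \<in> carrier ?E" "\<psi> \<in> carrier ?E" for \<phi> \<psi>
  proof -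
    have "compose X (\<psi> X act) (\<phi> X act) \<in> X \<rightarrow>\<^sub>E X" if "continuous_M_set M \<tau> X act" for X act
      using endo_op_maps[OF p(1) that] endo_op_maps[OF p(2) that]
      by (auto simp: compose_def)
    moreover have "compose X (\<psi> X act) (\<phi> X act) = (\<lambda>x. undefined)"
      if "\<not> continuous_M_set M \<tau> X act" for X act
      using p that by (simp add: endo_op_def compose_def restrict_def)
    moreover have "f (compose X (\<psi> X act) (\<phi> X act) x) = compose Y (\<psi> Y act') (\<phi> Y act') (f x)"
      if h: "continuous_M_set M \<tau> X act" "continuous_M_set M \<tau> Y act'"
        "equivariant M X act Y act' f" "x \<in> X" for X act Y act' f x
    proof -
      have "\<phi> X act x \<in> X" "f x \<in> Y"
        using endo_op_maps[OF p(1) h(1)] h by (auto simp: equivariant_def)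
      then show ?thesis
        using endo_op_natural[OF p(1) h] endo_op_natural[OF p(2) h(1-3)] h(4)
        by (simp add: compose_def)
    qed
    ultimately show ?thesis by (auto simp: endo_op_def)
  qed
  have "?T (\<phi> \<otimes>\<^bsub>?E\<^esub> \<psi>) = ?T \<phi> \<otimes>\<^bsub>?L\<^esub> ?T \<psi>" if p: "\<phi> \<in> carrier ?E" "\<psi> \<in> carrier ?E" for \<phi> \<psi>
  proof (rule limit_eqI)
    show "?T (\<phi> \<otimes>\<^bsub>?E\<^esub> \<psi>) \<in> carrier ?L" "?T \<phi> \<otimes>\<^bsub>?L\<^esub> ?T \<psi> \<in> carrier ?L"
      using lim mcl p limit_mult_closed[OF M] by blast+
    fix r assume r: "r \<in> cont_congs M \<tau>"
    obtain a where a: "a \<in> ?T \<phi> r" "a \<in> carrier M" "?T \<phi> r = r `` {a}"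
      using limit_rep[OF lim[OF p(1)] r] by metis
    obtain b where b: "b \<in> ?T \<psi> (pull_cong M a r)" "b \<in> carrier M"
      using limit_rep[OF lim[OF p(2)] pull_cong_cont[OF M r a(2)]] by metis
    have "?T (\<phi> \<otimes>\<^bsub>?E\<^esub> \<psi>) r = \<psi> (carrier M // r) (quot_act M r) (?T \<phi> r)"
      using r by (simp add: endo_tuple_def endo_op_def compose_def quotientI)
    also have "\<dots> = quot_act M r (r `` {a}) b"
      unfolding a(3)
      by (rule ev[OF p(2) cont_congsD(3)[OF r]])
        (use a b stab_cong_cls[OF M(1) r a(2)] in \<open>auto intro: quotientI\<close>)
    also have "\<dots> = r `` {a \<otimes>\<^bsub>M\<^esub> b}" using quot_act_cls[OF M(1) cont_congsD(1)[OF r]] a b by simp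
    also have "\<dots> = (?T \<phi> \<otimes>\<^bsub>?L\<^esub> ?T \<psi>) r"
      using limit_mult[OF M lim[OF p(1)] lim[OF p(2)] r a(1) b(1)] by simp
    finally show "?T (\<phi> \<otimes>\<^bsub>?E\<^esub> \<psi>) r \<inter> (?T \<phi> \<otimes>\<^bsub>?L\<^esub> ?T \<psi>) r \<noteq> {}"
      using limit_mult_mem[OF M lim[OF p(1)] lim[OF p(2)] r a(1) b(1)] by auto
  qed
  then have hom: "?T \<in> hom ?E ?L" using lim by (auto simp: hom_def)
  have inj: "inj_on ?T (carrier ?E)"
  proof (rule inj_onI)
    fix \<phi> \<psi> assume p: "\<phi> \<in> carrier ?E" "\<psi> \<in> carrier ?E" and eq: "?T \<phi> = ?T \<psi>"
    have "\<phi> X act x = \<psi> X act x" for X act x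
    proof (cases "continuous_M_set M \<tau> X act \<and> x \<in> X")
      case True
      then obtain a where "a \<in> ?T \<phi> (stab_cong M act x)"
        using limit_rep[OF lim[OF p(1)] stab_cong_cont[OF M]] by metis
      then show ?thesis using ev[OF p(1), of X act x a] ev[OF p(2), of X act x a] eq True by simp
    next
      case False
      show ?thesis
      proof (cases "continuous_M_set M \<tau> X act")
        case True
        with False endo_op_maps[OF p(1) True] endo_op_maps[OF p(2) True]
        show ?thesis by (simp add: PiE_def extensional_def)
      next
        case False
        then show ?thesis using p by (simp add: endo_op_def)
      qed
    qed
    then show "\<phi> = \<psi>" by blast
  qed
  have surj: "\<alpha> \<in> ?T ` carrier ?E" if \<alpha>: "\<alpha> \<in> carrier ?L" for \<alpha>
  proof -
    define \<phi> :: "'m set set \<Rightarrow> ('m set \<Rightarrow> 'm \<Rightarrow> 'm set) \<Rightarrow> 'm set \<Rightarrow> 'm set"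
      where "\<phi> X act = (if continuous_M_set M \<tau> X act
        then \<lambda>x\<in>X. act x (SOME a. a \<in> \<alpha> (stab_cong M act x)) else (\<lambda>x. undefined))" for X act
    have \<phi>: "\<phi> X act x = act x a"
      if h: "continuous_M_set M \<tau> X act" "x \<in> X" "a \<in> \<alpha> (stab_cong M act x)" for X act x a
    proof -
      have s: "stab_cong M act x \<in> cont_congs M \<tau>" by (rule stab_cong_cont[OF M h(1,2)])
      have "(SOME a. a \<in> \<alpha> (stab_cong M act x)) \<in> \<alpha> (stab_cong M act x)"
        using h(3) by (rule someI)
      then have "(a, SOME a. a \<in> \<alpha> (stab_cong M act x)) \<in> stab_cong M act x"
        using limit_cls(2)[OF \<alpha> s h(3)] by auto
      then show ?thesis using h by (simp add: \<phi>_def stab_cong_def)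
    qed
    have rep: "\<exists>a\<in>carrier M. a \<in> \<alpha> (stab_cong M act x)"
      if "continuous_M_set M \<tau> X act" "x \<in> X" for X and act :: "'m set \<Rightarrow> 'm \<Rightarrow> 'm set" and x
      using limit_rep[OF \<alpha> stab_cong_cont[OF M that]] by metis
    have "\<phi> X act \<in> X \<rightarrow>\<^sub>E X" if h: "continuous_M_set M \<tau> X act" for X act
    proof (rule PiE_I)
      fix x assume x: "x \<in> X"
      then obtain a where "a \<in> carrier M" "a \<in> \<alpha> (stab_cong M act x)" using rep[OF h] by blast
      then show "\<phi> X act x \<in> X"
        using \<phi>[OF h x] h x by (simp add: continuous_M_set_def right_M_set_def)
    qed (simp add: \<phi>_def h)
    moreover have "f (\<phi> X act x) = \<phi> Y act' (f x)"
      if h: "continuous_M_set M \<tau> X act" "continuous_M_set M \<tau> Y act'"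
        "equivariant M X act Y act' f" "x \<in> X" for X act Y act' f x
    proof -
      obtain a where a: "a \<in> carrier M" "a \<in> \<alpha> (stab_cong M act x)" using rep[OF h(1,4)] by blast
      have y: "f x \<in> Y" and fa: "\<And>m. m \<in> carrier M \<Longrightarrow> f (act x m) = act' (f x) m"
        using h(3,4) by (auto simp: equivariant_def)
      have "stab_cong M act x \<subseteq> stab_cong M act' (f x)"
        using fa unfolding stab_cong_def by (clarsimp simp flip: fa)
      then have "a \<in> \<alpha> (stab_cong M act' (f x))"
        using limit_mono[OF \<alpha> stab_cong_cont[OF M h(1,4)] stab_cong_cont[OF M h(2) y]] a by blast
      then show ?thesis using \<phi>[OF h(1,4) a(2)] \<phi>[OF h(2) y] fa[OF a(1)] by simp
    qed
    ultimately have E: "\<phi> \<in> carrier ?E" by (auto simp: endo_op_def \<phi>_def)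
    have "?T \<phi> = \<alpha>"
    proof (rule limit_eqI[OF lim[OF E] \<alpha>])
      fix r assume r: "r \<in> cont_congs M \<tau>"
      obtain a where a: "a \<in> \<alpha> r" "a \<in> carrier M" using limit_rep[OF \<alpha> r] by metis
      have "stab_cong M (quot_act M r) (r `` {\<one>\<^bsub>M\<^esub>}) = r"
        using stab_cong_cls[OF M(1) r one_closed] pull_cong_one[OF M(1) cont_congsD(2)[OF r]]
        by simp
      then have "?T \<phi> r = quot_act M r (r `` {\<one>\<^bsub>M\<^esub>}) a"
        using \<phi>[OF cont_congsD(3)[OF r], of "r `` {\<one>\<^bsub>M\<^esub>}" a] a r
        by (simp add: endo_tuple_def quotientI)
      then have "?T \<phi> r = r `` {a}"
        using quot_act_cls[OF M(1) cont_congsD(1)[OF r] one_closed a(2)] a by simp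
      then show "?T \<phi> r \<inter> \<alpha> r \<noteq> {}"
        using a equiv_class_self[OF cont_congsD(2)[OF r] a(2)] by auto
    qed
    then show ?thesis using E by blast
  qed
  have "bij_betw ?T (carrier ?E) (carrier ?L)"
    unfolding bij_betw_def using inj surj lim by auto
  then show ?thesis using hom by (simp add: iso_def)
qed

end

theory Submission
  imports Defs
begin

text \<open>
  That \<open>u\<close> is a continuous homomorphism holds for every topological monoid: the class of \<open>m\<close>
  modulo \<open>r\<close> is the value at \<open>m\<close> of the orbit map of \<open>[1]\<close> in the \<open>(M, \<tau>)\<close>-set \<open>M / r\<close>.
  For injectivity, each basic open set \<open>A\<close> of an action topology yields the right congruence
  \<open>m\<^sup>*(A) = n\<^sup>*(A)\<close>, whose quotient is an \<open>(M, \<tau>)\<close>-set precisely because the sets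
  \<open>same_pull M p (pull_set M q A)\<close> are open. If \<open>A\<close> contains exactly one of \<open>x\<close> and \<open>y\<close>, then
  exactly one of \<open>x\<^sup>*(A)\<close> and \<open>y\<^sup>*(A)\<close> contains \<open>1\<close>, so that this congruence separates \<open>x\<close> from \<open>y\<close>;
  by the \<open>T\<^sub>0\<close> axiom such an \<open>A\<close> exists whenever \<open>x \<noteq> y\<close>.
\<close>

lemma cont_congs_openin_class:
  assumes "monoid M" "topspace \<tau> = carrier M" "r \<in> cont_congs M \<tau>" "b \<in> carrier M"
  shows "openin \<tau> {m \<in> carrier M. r `` {m} = r `` {b}}"
proof -
  interpret monoid M by fact
  have "{m \<in> carrier M. r `` {m} = r `` {b}} = {m \<in> carrier M. (\<one>\<^bsub>M\<^esub> \<otimes>\<^bsub>M\<^esub> m, b) \<in> r}"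
    using assms(4) by (simp add: cls_eq_iff[OF cont_congsD(2)[OF assms(3)]] cong: conj_cong)
  then show ?thesis
    using assms by (simp add: cont_congs_iff)
qed

lemma canonical_hom_closed:
  assumes "m \<in> carrier M"
  shows "canonical_hom M \<tau> m \<in> carrier (endo_limit M \<tau>)"
proof (rule limitI)
  show "canonical_hom M \<tau> m r \<inter> canonical_hom M \<tau> m s \<noteq> {}"
    if "r \<in> cont_congs M \<tau>" "s \<in> cont_congs M \<tau>" for r s
    using that assms equiv_class_self[OF cont_congsD(2), of _ M \<tau> m]
    by (auto simp: canonical_hom_def)
qed (use assms in \<open>auto simp: canonical_hom_def\<close>)

lemma canonical_hom_in_hom:
  assumes "monoid M" "topspace \<tau> = carrier M"
  shows "canonical_hom M \<tau> \<in> hom M (endo_limit M \<tau>)"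
proof (rule homI)
  interpret monoid M by fact
  have mem: "m \<in> canonical_hom M \<tau> m r" if "m \<in> carrier M" "r \<in> cont_congs M \<tau>" for m r
    using that equiv_class_self[OF cont_congsD(2)] by (simp add: canonical_hom_def)
  fix x y assume xy: "x \<in> carrier M" "y \<in> carrier M"
  note cl = canonical_hom_closed[of _ M \<tau>]
  show "canonical_hom M \<tau> (x \<otimes>\<^bsub>M\<^esub> y)
      = canonical_hom M \<tau> x \<otimes>\<^bsub>endo_limit M \<tau>\<^esub> canonical_hom M \<tau> y"
  proof (rule limit_eqI)
    fix r assume r: "r \<in> cont_congs M \<tau>"
    \<comment> \<open>Elements of the limit are equal once their classes meet at every
      \<open>r\<close>. Here both classes contain the product of \<open>x\<close> and
      \<open>y\<close>, since \<open>y\<close> represents its image at every index, including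
      \<open>pull_cong M x r\<close>.\<close>
    show "canonical_hom M \<tau> (x \<otimes>\<^bsub>M\<^esub> y) r
        \<inter> (canonical_hom M \<tau> x \<otimes>\<^bsub>endo_limit M \<tau>\<^esub> canonical_hom M \<tau> y) r \<noteq> {}"
      using mem[OF m_closed[OF xy] r] limit_mult_mem[OF assms cl cl r
          mem[OF xy(1) r] mem[OF xy(2) pull_cong_cont[OF assms r xy(1)]]] xy by blast
  qed (use xy cl limit_mult_closed[OF assms] in auto)
qed (rule canonical_hom_closed)

lemma canonical_hom_one: "canonical_hom M \<tau> \<one>\<^bsub>M\<^esub> = \<one>\<^bsub>endo_limit M \<tau>\<^esub>"
  by (simp add: canonical_hom_def endo_limit_def)

lemma continuous_map_canonical_hom:
  assumes "monoid M" "topspace \<tau> = carrier M"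
  shows "continuous_map \<tau> (endo_topology M \<tau>) (canonical_hom M \<tau>)"
  unfolding endo_topology_def
proof (rule continuous_on_generated_topo)
  let ?B = "{{\<alpha> \<in> carrier (endo_limit M \<tau>). \<alpha> r \<in> S} | r S.
          r \<in> cont_congs M \<tau> \<and> S \<subseteq> carrier M // r}"
  have "\<Union> ?B = carrier (endo_limit M \<tau>)"
    using topspace_endo_topology[OF assms]
    unfolding endo_topology_def topology_generated_by_topspace .
  then show "canonical_hom M \<tau> ` topspace \<tau> \<subseteq> \<Union> ?B"
    using canonical_hom_closed[of _ M \<tau>] assms(2) by auto
  fix U assume "U \<in> ?B"
  then obtain r S where U: "U = {\<alpha> \<in> carrier (endo_limit M \<tau>). \<alpha> r \<in> S}"
      "r \<in> cont_congs M \<tau>" by blast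
  \<comment> \<open>Membership in the subbasic set \<open>U\<close> depends only on the class modulo
    \<open>r\<close>, so the preimage is a union of open classes.\<close>
  have "canonical_hom M \<tau> -` U \<inter> topspace \<tau>
      = (\<Union>b\<in>{b \<in> carrier M. r `` {b} \<in> S}. {m \<in> carrier M. r `` {m} = r `` {b}})"
    using assms(2) canonical_hom_closed[of _ M \<tau>] by (auto simp: U canonical_hom_def)
  moreover have "openin \<tau> \<dots>"
    using cont_congs_openin_class[OF assms U(2)] by blast
  ultimately show "openin \<tau> (canonical_hom M \<tau> -` U \<inter> topspace \<tau>)"
    by simp
qed

text \<open>For \<open>A\<close> inside the carrier, this is the stabiliser congruence of
  \<open>A\<close> in the right M-set of subsets of M, where \<open>m\<close> sends \<open>B\<close>
  to \<open>pull_set M m B\<close>.\<close>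

definition pull_set_cong :: "('m, 'b) monoid_scheme \<Rightarrow> 'm set \<Rightarrow> ('m \<times> 'm) set" where
  "pull_set_cong M A = {(m, n) \<in> carrier M \<times> carrier M. pull_set M m A = pull_set M n A}"

lemma pull_set_mult:
  assumes "monoid M" "p \<in> carrier M" "m \<in> carrier M"
  shows "pull_set M (p \<otimes>\<^bsub>M\<^esub> m) A = pull_set M m (pull_set M p A)"
proof -
  interpret monoid M by fact
  show ?thesis using assms by (auto simp: pull_set_def m_assoc)
qed

lemma one_in_pull_set_iff:
  assumes "monoid M" "m \<in> carrier M"
  shows "\<one>\<^bsub>M\<^esub> \<in> pull_set M m A \<longleftrightarrow> m \<in> A"
proof -
  interpret monoid M by fact
  show ?thesis using assms by (simp add: pull_set_def)
qed

lemma pull_set_cong_cont: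
  assumes "monoid M" "topspace \<tau> = carrier M"
    and "\<And>p q. p \<in> carrier M \<Longrightarrow> q \<in> carrier M \<Longrightarrow> openin \<tau> (same_pull M p (pull_set M q A))"
  shows "pull_set_cong M A \<in> cont_congs M \<tau>"
proof -
  interpret monoid M by fact
  have "right_congruence M (pull_set_cong M A)"
    by (auto simp: right_congruence_def pull_set_cong_def pull_set_mult[OF assms(1)]
        intro!: equivI refl_onI symI transI)
  moreover have "openin \<tau> {m \<in> carrier M. (a \<otimes>\<^bsub>M\<^esub> m, b) \<in> pull_set_cong M A}" (is "openin \<tau> ?V")
    if ab: "a \<in> carrier M" "b \<in> carrier M" for a b
  \<comment> \<open>\<open>pull_set M b A\<close> need not have the form
    \<open>pull_set M p (pull_set M a A)\<close> that \<open>same_pull\<close> requires; any element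
    of \<open>?V\<close> supplies such a \<open>p\<close>.\<close>
  proof (cases "?V = {}")
    case False
    then obtain p where "p \<in> carrier M" "pull_set M p (pull_set M a A) = pull_set M b A"
      using ab by (auto simp: pull_set_cong_def pull_set_mult[OF assms(1)])
    moreover from this have "?V = same_pull M p (pull_set M a A)"
      using ab by (auto simp: pull_set_cong_def same_pull_def pull_set_mult[OF assms(1)])
    ultimately show ?thesis using assms(3) ab by simp
  qed (simp only: openin_empty)
  ultimately show ?thesis by (simp add: cont_congs_iff[OF assms(1,2)])
qed

lemma inj_on_canonical_hom:
  assumes "monoid M" "topspace \<tau> = carrier M" "t0_space \<tau>" "action_topology M \<tau>"
  shows "inj_on (canonical_hom M \<tau>) (carrier M)"
proof (rule inj_onI, rule ccontr)
  fix x y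
  assume xy: "x \<in> carrier M" "y \<in> carrier M" and eq: "canonical_hom M \<tau> x = canonical_hom M \<tau> y"
    and "x \<noteq> y"
  then obtain U where "openin \<tau> U" and U: "x \<in> U \<longleftrightarrow> y \<notin> U"
    using assms(2,3) unfolding t0_space_def by blast
  \<comment> \<open>The defining equation has \<open>openin \<tau>\<close> on both sides, so it is
    applied at \<open>U\<close> only.\<close>
  have "(arbitrary union_of (\<lambda>A. A \<subseteq> carrier M \<and>
         (\<forall>p\<in>carrier M. \<forall>q\<in>carrier M. openin \<tau> (same_pull M p (pull_set M q A))))) U"
    using \<open>openin \<tau> U\<close> assms(4) unfolding action_topology_def by (rule back_subst[of "\<lambda>P. P U"])
  then obtain \<U> where \<U>: "\<Union> \<U> = U"
      "\<And>A p q. A \<in> \<U> \<Longrightarrow> p \<in> carrier M \<Longrightarrow> q \<in> carrier M \<Longrightarrow>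
        openin \<tau> (same_pull M p (pull_set M q A))"
    unfolding union_of_def by blast
  \<comment> \<open>The point in \<open>U\<close> lies in some member of the union; the other point
    lies in none.\<close>
  obtain A where A: "A \<in> \<U>" "x \<in> A \<longleftrightarrow> y \<notin> A"
    using U \<U>(1) by blast
  let ?r = "pull_set_cong M A"
  have r: "?r \<in> cont_congs M \<tau>"
    using \<U>(2)[OF A(1)] by (rule pull_set_cong_cont[OF assms(1,2)])
  then have "?r `` {x} = ?r `` {y}"
    using eq by (metis canonical_hom_def restrict_apply')
  then have "(x, y) \<in> ?r"
    using xy cls_eq_iff[OF cont_congsD(2)[OF r]] by blast
  then have "pull_set M x A = pull_set M y A"
    by (simp add: pull_set_cong_def)
  with A(2) xy show False
    using one_in_pull_set_iff[OF assms(1)] by blast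
qed

theorem corollary3p24:
  fixes M :: "('m, 'b) monoid_scheme" and \<tau> :: "'m topology"
  assumes "powder_monoid M \<tau>"
  shows "canonical_hom M \<tau> \<in> hom M (endo_limit M \<tau>) \<and>
         canonical_hom M \<tau> \<one>\<^bsub>M\<^esub> = \<one>\<^bsub>endo_limit M \<tau>\<^esub> \<and>
         inj_on (canonical_hom M \<tau>) (carrier M) \<and>
         continuous_map \<tau> (endo_topology M \<tau>) (canonical_hom M \<tau>)"
proof -
  have "monoid M" "topspace \<tau> = carrier M" "t0_space \<tau>" "action_topology M \<tau>"
    using assms by (auto simp: powder_monoid_def topological_monoid_def)
  then show ?thesis
    by (intro conjI canonical_hom_in_hom canonical_hom_one inj_on_canonical_hom
        continuous_map_canonical_hom)
qed

end
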